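(* Let $\sigma(y)=\frac{Ay+B}{Cy+D}$ with $A,B,C,D\in\mathbb{Z}$ and $|AD-BC|=2$, let $x$ be an infinite continued fraction, and let $\{U_t/V_t\}_{t\ge0}$ be the convergents of $\sigma(x)$. With $k_0\ge1$ the integer at which the tail of $\sigma(x)$ (one of those listed in the context) starts, put $p_0=k_0-1$ and define the functions $$g(p)=p_0+p+2\left\lfloor\tfrac p3\right\rfloor,\qquad h(p)=p_0+2p-1+\sin\left(\tfrac{(p+1)\pi}{2}\right),$$ $$v(p)=2^{\sin\left(\left(p+1+\left\lfloor\frac{p+2}{3}\right\rfloor\right)\frac{\pi}{2}\right)},\qquad z(p)=2^{\sin\left(\frac{(p+2)\pi}{2}\right)},$$ for $p\ge2$. Then the sequences $\{U_t\}_{t\ge0}$ and $\{V_t\}_{t\ge0}$ satisfy one of the following nonlinear recurrence relations: 1) $$U_{s(p)}=e_{l_1(p)}U_{s(p-1)}+U_{s(p-2)},\qquad V_{s(p)}=e_{l_1(p)}V_{s(p-1)}+V_{s(p-2)},$$ when $x$ is a continued fraction of type CF1, with tail (1a), where $s(p)=p_0+3p$ and $l_1(p)=k_0+p-2$; 2) $$U_{g(p)}=G(p)U_{g(p-1)}+v(p)U_{g(p-2)},\qquad V_{g(p)}=G(p)V_{g(p-1)}+v(p)V_{g(p-2)},$$ when $x$ is a continued fraction of type CF2, where $$G(p)=d_{l_2(p)}\,2^{\sin\left(\left(p+2+\left\lfloor\frac{p+1}{3}\right\rfloor\right)\frac{\pi}{2}\right)}$$ and $l_2(p)=3k_0+p-4$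 for tail (2a), $l_2(p)=3k_0+p-3$ for tail (2b), $l_2(p)=3k_0+p-2$ for tail (2c); 3) $$U_{h(p)}=H(p)U_{h(p-1)}+z(p)U_{h(p-2)},\qquad V_{h(p)}=H(p)V_{h(p-1)}+z(p)V_{h(p-2)},$$ when $x$ is a continued fraction of type CF3 or CF4, where $$H(p)=a_{l_{3,4}(p)}\,2^{\sin\left(\left(p+2+\left\lfloor\frac{p+2}{4}\right\rfloor-\left\lfloor\frac p4\right\rfloor\right)\frac{\pi}{2}\right)}$$ and $l_{3,4}(p)=4k_0+p-5$ for tail (3a), $l_{3,4}(p)=4k_0+p-3$ for tail (3b), $l_{3,4}(p)=4k_0+p-4$ for tail (4a), $l_{3,4}(p)=4k_0+p-2$ for tail (4c), with $a_{l_{3,4}(p)}=e_{l_{3,4}(p)}$ if $p$ is even and $a_{l_{3,4}(p)}=d_{l_{3,4}(p)}$ if $p$ is odd.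
   Context: $[b_0,b_1,b_2,\ldots]$ denotes the infinite simple continued fraction $b_0+\cfrac{1}{b_1+\cfrac{1}{b_2+\cdots}}$; its $t$-th convergent is $[b_0,\ldots,b_t]$, and for $\sigma(x)$ the numerator and denominator of the $t$-th convergent are $U_t$ and $V_t$. Its $n$-th tail is $[b_{n+1},b_{n+2},\ldots]$. Types of continued fractions for $x$ (all partial quotients are positive integers; $e_i$ always even, $d_i$ always odd): CF1: $[e_0,e_1,e_2,\ldots]$. CF2: $[d_0,d_1,d_2,\ldots]$. CF3: $[d_0,e_1,d_2,e_3,\ldots]$. CF4: $[e_0,d_1,e_2,d_3,\ldots]$. The symbol $[\overline{f_1(k),\ldots,f_r(k)}]_{k=k_0}^{+\infty}$ denotes $[f_1(k_0),\ldots,f_r(k_0),f_1(k_0+1),\ldots,f_r(k_0+1),\ldots]$. Tails of $\sigma(x)$ referred to in the claim, each with the inequalities under which it is considered, required for all $k\ge k_0\ge1$: (1a) $[\overline{\frac{e_{k-1}-2}{2},1,1}]_{k=k_0}^{+\infty}$, $e_{k-1}\ge4$; (2a) $[\overline{\frac{d_{3k-3}-1}{2},2d_{3k-2},\frac{d_{3k-1}-1}{2},1,1}]_{k=k_0}^{+\infty}$, $d_{3k-3},d_{3k-1}\ge3$; (2b) $[\overline{\frac{d_{3k-2}-1}{2},2d_{3k-1},\frac{d_{3k}-1}{2},1,1}]_{k=k_0}^{+\infty}$, $d_{3k-2},d_{3k}\ge3$; (2c) $[\overline{\frac{d_{3k-1}-1}{2},2d_{3k},\frac{d_{3k+1}-1}{2},1,1}]_{k=k_0}^{+\infty}$,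 $d_{3k-1},d_{3k+1}\ge3$; (3a) $[\overline{\frac{d_{4k-4}-1}{2},2e_{4k-3},\frac{d_{4k-2}-1}{2},1,1,\frac{e_{4k-1}-2}{2},1,1}]_{k=k_0}^{+\infty}$, $d_{4k-4},d_{4k-2}\ge3$, $e_{4k-1}\ge4$; (3b) $[\overline{\frac{d_{4k-2}-1}{2},2e_{4k-1},\frac{d_{4k}-1}{2},1,1,\frac{e_{4k+1}-2}{2},1,1}]_{k=k_0}^{+\infty}$, $d_{4k-2},d_{4k}\ge3$, $e_{4k+1}\ge4$; (4a) $[\overline{\frac{d_{4k-3}-1}{2},2e_{4k-2},\frac{d_{4k-1}-1}{2},1,1,\frac{e_{4k}-2}{2},1,1}]_{k=k_0}^{+\infty}$, $d_{4k-3},d_{4k-1}\ge3$, $e_{4k}\ge4$; (4c) $[\overline{\frac{d_{4k-1}-1}{2},2e_{4k},\frac{d_{4k+1}-1}{2},1,1,\frac{e_{4k+2}-2}{2},1,1}]_{k=k_0}^{+\infty}$, $d_{4k-1},d_{4k+1}\ge3$, $e_{4k+2}\ge4$. *)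

theory Defs
  imports Complex_Main
begin

fun cf_convergent :: "(nat \<Rightarrow> int) \<Rightarrow> nat \<Rightarrow> rat" where
  "cf_convergent b 0 = of_int (b 0)"
| "cf_convergent b (Suc t) = of_int (b 0) + 1 / cf_convergent (\<lambda>i. b (Suc i)) t"

text \<open>Numerator and denominator of the reduced fraction with positive denominator.\<close>

definition cf_num :: "(nat \<Rightarrow> int) \<Rightarrow> nat \<Rightarrow> int" where
  "cf_num b t = fst (quotient_of (cf_convergent b t))"

definition cf_den :: "(nat \<Rightarrow> int) \<Rightarrow> nat \<Rightarrow> int" where
  "cf_den b t = snd (quotient_of (cf_convergent b t))"

text \<open>\<open>y\<close> is the value of the infinite simple continued fraction with partial quotients \<open>b\<close>.
  The integer part \<open>b 0\<close> may be zero or negative, since it is the integer part of an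
  arbitrary \<open>\<sigma>(x)\<close>.\<close>

definition is_simple_cf :: "(nat \<Rightarrow> int) \<Rightarrow> real \<Rightarrow> bool" where
  "is_simple_cf b y \<longleftrightarrow>
     (\<forall>i\<ge>1. b i \<ge> 1) \<and> (\<lambda>t. real_of_rat (cf_convergent b t)) \<longlonglongrightarrow> y"

text \<open>The \<open>n\<close>-th tail \<open>[b\<^sub>n\<^sub>+\<^sub>1, b\<^sub>n\<^sub>+\<^sub>2, \<dots>]\<close>; it starts at the partial quotient of index \<open>n + 1\<close>.\<close>

definition cf_tail :: "nat \<Rightarrow> (nat \<Rightarrow> int) \<Rightarrow> nat \<Rightarrow> int" where
  "cf_tail n b i = b (n + 1 + i)"

text \<open>The sequence \<open>f\<^sub>1(k\<^sub>0), \<dots>, f\<^sub>r(k\<^sub>0), f\<^sub>1(k\<^sub>0+1), \<dots>, f\<^sub>r(k\<^sub>0+1), \<dots>\<close>.\<close>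

definition cf_repeat :: "(nat \<Rightarrow> int) list \<Rightarrow> nat \<Rightarrow> nat \<Rightarrow> int" where
  "cf_repeat fs k0 i = (fs ! (i mod length fs)) (k0 + i div length fs)"

text \<open>The types of the continued fraction \<open>[a\<^sub>0, a\<^sub>1, \<dots>]\<close> of \<open>x\<close>. A partial quotient \<open>a i\<close> is
  written \<open>e\<^sub>i\<close> when it is even and \<open>d\<^sub>i\<close> when it is odd.\<close>

definition CF1 :: "(nat \<Rightarrow> int) \<Rightarrow> bool" where
  "CF1 a \<longleftrightarrow> (\<forall>i. a i > 0 \<and> even (a i))"

definition CF2 :: "(nat \<Rightarrow> int) \<Rightarrow> bool" where
  "CF2 a \<longleftrightarrow> (\<forall>i. a i > 0 \<and> odd (a i))"

definition CF3 :: "(nat \<Rightarrow> int) \<Rightarrow> bool" where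
  "CF3 a \<longleftrightarrow> (\<forall>i. a i > 0 \<and> (even i \<longrightarrow> odd (a i)) \<and> (odd i \<longrightarrow> even (a i)))"

definition CF4 :: "(nat \<Rightarrow> int) \<Rightarrow> bool" where
  "CF4 a \<longleftrightarrow> (\<forall>i. a i > 0 \<and> (even i \<longrightarrow> even (a i)) \<and> (odd i \<longrightarrow> odd (a i)))"

text \<open>The tails of \<open>\<sigma>(x) = [b\<^sub>0, b\<^sub>1, \<dots>]\<close>. The parameter \<open>k0\<close> is both the first value of the
  running index \<open>k\<close> and the index of the partial quotient of \<open>\<sigma>(x)\<close> at which the tail starts, so
  that the tail is the \<open>p\<^sub>0\<close>-th one for \<open>p\<^sub>0 = k0 - 1\<close>. For \<open>x\<close> of the corresponding
  type every integer division by \<open>2\<close> is exact, and for \<open>k \<ge> k0 \<ge> 1\<close> no subtraction on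
  \<^typ>\<open>nat\<close> is truncated.\<close>

definition tail_1a :: "(nat \<Rightarrow> int) \<Rightarrow> (nat \<Rightarrow> int) \<Rightarrow> nat \<Rightarrow> bool" where
  "tail_1a a b k0 \<longleftrightarrow>
     (\<forall>k\<ge>k0. a (k-1) \<ge> 4) \<and>
     cf_tail (k0 - 1) b = cf_repeat [\<lambda>k. (a (k-1) - 2) div 2, \<lambda>k. 1, \<lambda>k. 1] k0"

definition tail_2a :: "(nat \<Rightarrow> int) \<Rightarrow> (nat \<Rightarrow> int) \<Rightarrow> nat \<Rightarrow> bool" where
  "tail_2a a b k0 \<longleftrightarrow>
     (\<forall>k\<ge>k0. a (3*k-3) \<ge> 3 \<and> a (3*k-1) \<ge> 3) \<and>
     cf_tail (k0 - 1) b = cf_repeat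
       [\<lambda>k. (a (3*k-3) - 1) div 2, \<lambda>k. 2 * a (3*k-2), \<lambda>k. (a (3*k-1) - 1) div 2,
        \<lambda>k. 1, \<lambda>k. 1] k0"

definition tail_2b :: "(nat \<Rightarrow> int) \<Rightarrow> (nat \<Rightarrow> int) \<Rightarrow> nat \<Rightarrow> bool" where
  "tail_2b a b k0 \<longleftrightarrow>
     (\<forall>k\<ge>k0. a (3*k-2) \<ge> 3 \<and> a (3*k) \<ge> 3) \<and>
     cf_tail (k0 - 1) b = cf_repeat
       [\<lambda>k. (a (3*k-2) - 1) div 2, \<lambda>k. 2 * a (3*k-1), \<lambda>k. (a (3*k) - 1) div 2,
        \<lambda>k. 1, \<lambda>k. 1] k0"

definition tail_2c :: "(nat \<Rightarrow> int) \<Rightarrow> (nat \<Rightarrow> int) \<Rightarrow> nat \<Rightarrow> bool" where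
  "tail_2c a b k0 \<longleftrightarrow>
     (\<forall>k\<ge>k0. a (3*k-1) \<ge> 3 \<and> a (3*k+1) \<ge> 3) \<and>
     cf_tail (k0 - 1) b = cf_repeat
       [\<lambda>k. (a (3*k-1) - 1) div 2, \<lambda>k. 2 * a (3*k), \<lambda>k. (a (3*k+1) - 1) div 2,
        \<lambda>k. 1, \<lambda>k. 1] k0"

definition tail_3a :: "(nat \<Rightarrow> int) \<Rightarrow> (nat \<Rightarrow> int) \<Rightarrow> nat \<Rightarrow> bool" where
  "tail_3a a b k0 \<longleftrightarrow>
     (\<forall>k\<ge>k0. a (4*k-4) \<ge> 3 \<and> a (4*k-2) \<ge> 3 \<and> a (4*k-1) \<ge> 4) \<and>
     cf_tail (k0 - 1) b = cf_repeat
       [\<lambda>k. (a (4*k-4) - 1) div 2, \<lambda>k. 2 * a (4*k-3), \<lambda>k. (a (4*k-2) - 1) div 2,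
        \<lambda>k. 1, \<lambda>k. 1, \<lambda>k. (a (4*k-1) - 2) div 2, \<lambda>k. 1, \<lambda>k. 1] k0"

definition tail_3b :: "(nat \<Rightarrow> int) \<Rightarrow> (nat \<Rightarrow> int) \<Rightarrow> nat \<Rightarrow> bool" where
  "tail_3b a b k0 \<longleftrightarrow>
     (\<forall>k\<ge>k0. a (4*k-2) \<ge> 3 \<and> a (4*k) \<ge> 3 \<and> a (4*k+1) \<ge> 4) \<and>
     cf_tail (k0 - 1) b = cf_repeat
       [\<lambda>k. (a (4*k-2) - 1) div 2, \<lambda>k. 2 * a (4*k-1), \<lambda>k. (a (4*k) - 1) div 2,
        \<lambda>k. 1, \<lambda>k. 1, \<lambda>k. (a (4*k+1) - 2) div 2, \<lambda>k. 1, \<lambda>k. 1] k0"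

definition tail_4a :: "(nat \<Rightarrow> int) \<Rightarrow> (nat \<Rightarrow> int) \<Rightarrow> nat \<Rightarrow> bool" where
  "tail_4a a b k0 \<longleftrightarrow>
     (\<forall>k\<ge>k0. a (4*k-3) \<ge> 3 \<and> a (4*k-1) \<ge> 3 \<and> a (4*k) \<ge> 4) \<and>
     cf_tail (k0 - 1) b = cf_repeat
       [\<lambda>k. (a (4*k-3) - 1) div 2, \<lambda>k. 2 * a (4*k-2), \<lambda>k. (a (4*k-1) - 1) div 2,
        \<lambda>k. 1, \<lambda>k. 1, \<lambda>k. (a (4*k) - 2) div 2, \<lambda>k. 1, \<lambda>k. 1] k0"

definition tail_4c :: "(nat \<Rightarrow> int) \<Rightarrow> (nat \<Rightarrow> int) \<Rightarrow> nat \<Rightarrow> bool" where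
  "tail_4c a b k0 \<longleftrightarrow>
     (\<forall>k\<ge>k0. a (4*k-1) \<ge> 3 \<and> a (4*k+1) \<ge> 3 \<and> a (4*k+2) \<ge> 4) \<and>
     cf_tail (k0 - 1) b = cf_repeat
       [\<lambda>k. (a (4*k-1) - 1) div 2, \<lambda>k. 2 * a (4*k), \<lambda>k. (a (4*k+1) - 1) div 2,
        \<lambda>k. 1, \<lambda>k. 1, \<lambda>k. (a (4*k+2) - 2) div 2, \<lambda>k. 1, \<lambda>k. 1] k0"

text \<open>In the index and coefficient functions, \<open>\<lfloor>p/q\<rfloor>\<close> is \<open>p div q\<close> on \<^typ>\<open>nat\<close>, and
  \<open>p0 = k0 - 1\<close>.\<close>

definition s_idx :: "nat \<Rightarrow> nat \<Rightarrow> nat" where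
  "s_idx p0 p = p0 + 3 * p"

definition g_idx :: "nat \<Rightarrow> nat \<Rightarrow> nat" where
  "g_idx p0 p = p0 + p + 2 * (p div 3)"

text \<open>The real number to which \<open>nat\<close> and floor are applied is always a natural number;
  see the lemma \<open>of_nat_h_idx\<close>.\<close>

definition h_idx :: "nat \<Rightarrow> nat \<Rightarrow> nat" where
  "h_idx p0 p = nat \<lfloor>real p0 + 2 * real p - 1 + sin (real (p + 1) * pi / 2)\<rfloor>"

lemma sin_half_pi_cases:
  "sin (real n * pi / 2) =
     (if n mod 4 = 1 then 1 else if n mod 4 = 3 then - 1 else 0)"
proof -
  have n: "n = 4 * (n div 4) + n mod 4" by simp
  define q where "q = n div 4"
  have "real n = 4 * real q + real (n mod 4)"
    unfolding q_def using n by (metis of_nat_add of_nat_mult of_nat_numeral)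
  then have "real n * pi / 2 = real (n mod 4) * pi / 2 + 2 * real q * pi"
    by (simp add: algebra_simps add_divide_distrib)
  then have *: "sin (real n * pi / 2) = sin (real (n mod 4) * pi / 2)"
    by (simp only: sin_add sin_2npi cos_2npi mult_1_right mult_zero_right add_0_right)
  have "n mod 4 < 4" by simp
  then consider "n mod 4 = 0" | "n mod 4 = 1" | "n mod 4 = 2" | "n mod 4 = 3" by linarith
  then show ?thesis
  proof cases
    case 4
    have "sin (3 * pi / 2) = - 1"
      using sin_3over2_pi by (simp add: field_simps)
    with 4 * show ?thesis by simp
  qed (use * in simp_all)
qed

lemma of_nat_h_idx:
  "real (h_idx p0 p) = real p0 + 2 * real p - 1 + sin (real (p + 1) * pi / 2)"
proof -
  define m :: int where
    "m = int p0 + 2 * int p - 1 +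
       (if (p + 1) mod 4 = 1 then 1 else if (p + 1) mod 4 = 3 then - 1 else 0)"
  have eq: "real p0 + 2 * real p - 1 + sin (real (p + 1) * pi / 2) = of_int m"
    unfolding sin_half_pi_cases m_def by simp
  have "0 \<le> m" unfolding m_def by (cases "p = 0") auto
  then show ?thesis unfolding h_idx_def eq by simp
qed

definition v_coeff :: "nat \<Rightarrow> real" where
  "v_coeff p = 2 powr sin (real (p + 1 + (p + 2) div 3) * pi / 2)"

definition z_coeff :: "nat \<Rightarrow> real" where
  "z_coeff p = 2 powr sin (real (p + 2) * pi / 2)"

definition G_coeff :: "(nat \<Rightarrow> int) \<Rightarrow> (nat \<Rightarrow> nat) \<Rightarrow> nat \<Rightarrow> real" where
  "G_coeff a l p =
     real_of_int (a (l p)) * 2 powr sin (real (p + 2 + (p + 1) div 3) * pi / 2)"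

text \<open>For the index functions \<open>l\<close> of the types CF3 and CF4, \<open>a (l p)\<close> is even (an \<open>e\<close>) exactly
  for even \<open>p\<close> and odd (a \<open>d\<close>) exactly for odd \<open>p\<close>.\<close>

definition H_coeff :: "(nat \<Rightarrow> int) \<Rightarrow> (nat \<Rightarrow> nat) \<Rightarrow> nat \<Rightarrow> real" where
  "H_coeff a l p =
     real_of_int (a (l p)) *
     2 powr sin ((real (p + 2) + real ((p + 2) div 4) - real (p div 4)) * pi / 2)"

end

theory Submission
  imports Defs
begin

text \<open>
  The numerators and the denominators of the convergents of \<open>[b\<^sub>0, b\<^sub>1, \<dots>]\<close> both satisfy
  \<open>R\<^sub>n = b\<^sub>n R\<^bsub>n-1\<^esub> + R\<^bsub>n-2\<^esub>\<close>. The theorem contracts this recurrence: in each tail the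
  consecutive partial quotients \<open>1, 1\<close> are skipped over, and the terms that survive are related
  by the partial quotients of \<open>x\<close> themselves, up to powers of \<open>2\<close>.

  Two facts carry the contraction. First, the entries \<open>c, 1, 1\<close> lead from consecutive terms
  \<open>Y, X\<close> to \<open>(2c + 1) X + 2Y\<close> (lemma \<open>step_into_ones\<close>); for \<open>c = (d - 1)/2\<close> this is
  \<open>d X + 2Y\<close>. Secondly, after the same entries let \<open>X'\<close> be the last term and \<open>Y'\<close> the one before
  it; then \<open>2Y' = X' + X\<close> whatever \<open>c\<close> is (lemma \<open>twice_before_end_of_ones\<close>). Hence the
  skipped term \<open>Y'\<close> can be eliminated from what follows: an entry \<open>(d - 1)/2\<close> not followed
  by ones gives \<open>(d/2) X' + X/2\<close>, and a block \<open>(e - 2)/2, 1, 1\<close> gives \<open>e X' + X\<close>.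
  Together with the plain step at an entry \<open>2d\<close> or \<open>2e\<close>, these four steps account for all the cases; the sine exponents only record which step occurs at \<open>p\<close>, as they
  depend on \<open>p\<close> modulo \<open>3\<close> (type CF2) or \<open>4\<close> (types CF3 and CF4).
\<close>

section \<open>The recurrence of the convergents\<close>

definition cf_recurrence :: "(nat \<Rightarrow> int) \<Rightarrow> (nat \<Rightarrow> int) \<Rightarrow> bool" where
  "cf_recurrence b R \<longleftrightarrow> (\<forall>n. R (n + 2) = b (n + 2) * R (n + 1) + R n)"

fun continuant_num :: "(nat \<Rightarrow> int) \<Rightarrow> nat \<Rightarrow> int" where
  "continuant_num b 0 = b 0"
| "continuant_num b (Suc 0) = b 1 * b 0 + 1"
| "continuant_num b (Suc (Suc n)) = b (n + 2) * continuant_num b (Suc n) + continuant_num b n"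

fun continuant_den :: "(nat \<Rightarrow> int) \<Rightarrow> nat \<Rightarrow> int" where
  "continuant_den b 0 = 1"
| "continuant_den b (Suc 0) = b 1"
| "continuant_den b (Suc (Suc n)) = b (n + 2) * continuant_den b (Suc n) + continuant_den b n"

text \<open>The convergents are defined by peeling off the first partial quotient, whereas the
  recurrence appends a last one; this lemma connects the two.\<close>

lemma continuant_shift:
  "continuant_num b (Suc n) =
     b 0 * continuant_num (\<lambda>i. b (Suc i)) n + continuant_den (\<lambda>i. b (Suc i)) n \<and>
   continuant_den b (Suc n) = continuant_num (\<lambda>i. b (Suc i)) n"
proof (induction n rule: induct_nat_012)
  case (ge2 n)
  then show ?case by (simp add: algebra_simps)
qed (simp_all add: algebra_simps numeral_2_eq_2)

lemma continuant_den_pos: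
  assumes "\<And>i. i \<ge> 1 \<Longrightarrow> b i \<ge> 1"
  shows "continuant_den b n > 0"
proof (induction n rule: induct_nat_012)
  case 1
  show ?case using assms[of 1] by simp
next
  case (ge2 n)
  have "b (n + 2) * continuant_den b (Suc n) > 0"
    using ge2 assms[of "n + 2"] by (intro mult_pos_pos) auto
  with ge2 show ?case by simp
qed simp

lemma coprime_continuants: "coprime (continuant_num b n) (continuant_den b n)"
proof (induction n arbitrary: b)
  case (Suc n)
  let ?b = "\<lambda>i. b (Suc i)"
  have "gcd (b 0 * continuant_num ?b n + continuant_den ?b n) (continuant_num ?b n) = 1"
    using Suc[of ?b] by (metis coprime_iff_gcd_eq_1 gcd.commute gcd_add_mult mult.commute add.commute)
  then show ?case
    using continuant_shift[of b n] by (simp add: coprime_iff_gcd_eq_1)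
qed simp

lemma cf_convergent_eq_continuants:
  assumes "\<And>i. i \<ge> 1 \<Longrightarrow> b i \<ge> 1"
  shows "cf_convergent b n = of_int (continuant_num b n) / of_int (continuant_den b n)"
  using assms
proof (induction n arbitrary: b)
  case (Suc n)
  let ?b = "\<lambda>i. b (Suc i)"
  have "continuant_num ?b n > 0"
    using continuant_den_pos[of b "Suc n"] Suc.prems continuant_shift[of b n] by simp
  moreover have "cf_convergent ?b n = of_int (continuant_num ?b n) / of_int (continuant_den ?b n)"
    using Suc.IH[of ?b] Suc.prems by simp
  ultimately show ?case
    using continuant_shift[of b n] by (simp add: field_simps)
qed simp

lemma quotient_of_cf_convergent:
  assumes "\<And>i. i \<ge> 1 \<Longrightarrow> b i \<ge> 1"
  shows "quotient_of (cf_convergent b n) = (continuant_num b n, continuant_den b n)"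
proof -
  have "cf_convergent b n = Fract (continuant_num b n) (continuant_den b n)"
    using cf_convergent_eq_continuants[OF assms] by (simp add: Fract_of_int_quotient)
  then show ?thesis
    using coprime_continuants continuant_den_pos[OF assms]
    by (simp add: quotient_of_Fract normalize_stable)
qed

lemma cf_recurrence_cf_num:
  assumes "is_simple_cf b y"
  shows "cf_recurrence b (cf_num b)"
proof -
  have "cf_num b = continuant_num b"
    using assms quotient_of_cf_convergent[of b] unfolding is_simple_cf_def cf_num_def by auto
  then show ?thesis by (simp add: cf_recurrence_def)
qed

lemma cf_recurrence_cf_den:
  assumes "is_simple_cf b y"
  shows "cf_recurrence b (cf_den b)"
proof -
  have "cf_den b = continuant_den b"
    using assms quotient_of_cf_convergent[of b] unfolding is_simple_cf_def cf_den_def by auto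
  then show ?thesis by (simp add: cf_recurrence_def)
qed

section \<open>Skipping over a pair of ones\<close>

lemma cf_recurrenceD:
  assumes "cf_recurrence b R"
  shows "R (Suc (Suc n)) = b (Suc (Suc n)) * R (Suc n) + R n"
  using assms unfolding cf_recurrence_def by simp

text \<open>From consecutive terms \<open>W, Z\<close> the two ones produce \<open>Z + W\<close> and then \<open>2Z + W\<close>; twice
  the former minus the latter is \<open>W\<close>, so that \<open>Z\<close>, and with it the entry before the ones,
  drops out.\<close>

lemma twice_before_end_of_ones:
  assumes "cf_recurrence b R" "b (m + 2) = 1" "b (m + 3) = 1"
  shows "2 * R (m + 2) = R (m + 3) + R m"
  using assms cf_recurrenceD[OF assms(1), of m] cf_recurrenceD[OF assms(1), of "m + 1"]
  by (simp add: eval_nat_numeral)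

lemma step_into_ones:
  assumes "cf_recurrence b R" "b (m + 3) = 1" "b (m + 4) = 1"
  shows "R (m + 4) = (2 * b (m + 2) + 1) * R (m + 1) + 2 * R m"
  using assms cf_recurrenceD[OF assms(1), of m] cf_recurrenceD[OF assms(1), of "m + 1"]
    cf_recurrenceD[OF assms(1), of "m + 2"]
  by (simp add: eval_nat_numeral algebra_simps)

lemma step_out_of_ones:
  assumes "cf_recurrence b R" "b (m + 2) = 1" "b (m + 3) = 1"
  shows "2 * R (m + 4) = (2 * b (m + 4) + 1) * R (m + 3) + R m"
  using twice_before_end_of_ones[OF assms] cf_recurrenceD[OF assms(1), of "m + 2"]
  by (simp add: eval_nat_numeral algebra_simps)

lemma step_between_ones:
  assumes "cf_recurrence b R" "b (m + 2) = 1" "b (m + 3) = 1" "b (m + 5) = 1" "b (m + 6) = 1"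
  shows "R (m + 6) = (2 * b (m + 4) + 2) * R (m + 3) + R m"
  using twice_before_end_of_ones[OF assms(1-3)] step_into_ones[OF assms(1), of "m + 2"] assms(4,5)
  by (simp add: eval_nat_numeral algebra_simps)

section \<open>The indices and coefficients in each residue class\<close>

lemma cf_tail_block:
  assumes tail: "cf_tail p0 b = cf_repeat fs (Suc p0)" and r: "length fs = r" and i: "i < r"
  shows "b (p0 + r * j + Suc i) = (fs ! i) (Suc p0 + j)"
proof -
  have "(r * j + i) mod r = i" "(r * j + i) div r = j"
    using i by simp_all
  then show ?thesis
    using fun_cong[OF tail, of "r * j + i"] r
    by (simp add: cf_tail_def cf_repeat_def add.assoc)
qed

lemma g_idx_simps:
  "g_idx p0 (3 * j) = p0 + 5 * j"
  "g_idx p0 (3 * j + 1) = p0 + 5 * j + 1"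
  "g_idx p0 (3 * j + 2) = p0 + 5 * j + 2"
  "g_idx p0 (3 * j + 3) = p0 + 5 * j + 5"
  "g_idx p0 (3 * j + 4) = p0 + 5 * j + 6"
proof -
  have "(3 * j) div 3 = j" "(3 * j + 1) div 3 = j" "(3 * j + 2) div 3 = j"
    "(3 * j + 3) div 3 = j + 1" "(3 * j + 4) div 3 = j + 1" by presburger+
  then show
    "g_idx p0 (3 * j) = p0 + 5 * j"
    "g_idx p0 (3 * j + 1) = p0 + 5 * j + 1"
    "g_idx p0 (3 * j + 2) = p0 + 5 * j + 2"
    "g_idx p0 (3 * j + 3) = p0 + 5 * j + 5"
    "g_idx p0 (3 * j + 4) = p0 + 5 * j + 6"
    unfolding g_idx_def by linarith+
qed

lemma h_idx_simps:
  "h_idx p0 (4 * j) = p0 + 8 * j"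
  "h_idx p0 (4 * j + 1) = p0 + 8 * j + 1"
  "h_idx p0 (4 * j + 2) = p0 + 8 * j + 2"
  "h_idx p0 (4 * j + 3) = p0 + 8 * j + 5"
  "h_idx p0 (4 * j + 4) = p0 + 8 * j + 8"
  "h_idx p0 (4 * j + 5) = p0 + 8 * j + 9"
proof -
  have "(4 * j + 1) mod 4 = 1" "(4 * j + 1 + 1) mod 4 = 2" "(4 * j + 2 + 1) mod 4 = 3"
    "(4 * j + 3 + 1) mod 4 = 0" "(4 * j + 4 + 1) mod 4 = 1" "(4 * j + 5 + 1) mod 4 = 2"
    by presburger+
  then have
    "real (h_idx p0 (4 * j)) = real (p0 + 8 * j)"
    "real (h_idx p0 (4 * j + 1)) = real (p0 + 8 * j + 1)"
    "real (h_idx p0 (4 * j + 2)) = real (p0 + 8 * j + 2)"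
    "real (h_idx p0 (4 * j + 3)) = real (p0 + 8 * j + 5)"
    "real (h_idx p0 (4 * j + 4)) = real (p0 + 8 * j + 8)"
    "real (h_idx p0 (4 * j + 5)) = real (p0 + 8 * j + 9)"
    unfolding of_nat_h_idx sin_half_pi_cases by simp_all
  then show
    "h_idx p0 (4 * j) = p0 + 8 * j"
    "h_idx p0 (4 * j + 1) = p0 + 8 * j + 1"
    "h_idx p0 (4 * j + 2) = p0 + 8 * j + 2"
    "h_idx p0 (4 * j + 3) = p0 + 8 * j + 5"
    "h_idx p0 (4 * j + 4) = p0 + 8 * j + 8"
    "h_idx p0 (4 * j + 5) = p0 + 8 * j + 9"
    by (simp_all only: of_nat_eq_iff)
qed

lemma two_powr_sin_half_pi:
  "(2::real) powr sin (real n * pi / 2) =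
     (if n mod 4 = 1 then 2 else if n mod 4 = 3 then 1 / 2 else 1)"
  unfolding sin_half_pi_cases by (simp add: powr_minus)

lemma G_coeff_simps:
  "G_coeff a l (3 * j + 2) = 2 * of_int (a (l (3 * j + 2)))"
  "G_coeff a l (3 * j + 3) = of_int (a (l (3 * j + 3)))"
  "G_coeff a l (3 * j + 4) = of_int (a (l (3 * j + 4))) / 2"
proof -
  have "(3 * j + 2 + 2 + (3 * j + 2 + 1) div 3) mod 4 = 1"
    "(3 * j + 3 + 2 + (3 * j + 3 + 1) div 3) mod 4 = 2"
    "(3 * j + 4 + 2 + (3 * j + 4 + 1) div 3) mod 4 = 3" by presburger+
  then show "G_coeff a l (3 * j + 2) = 2 * of_int (a (l (3 * j + 2)))"
    "G_coeff a l (3 * j + 3) = of_int (a (l (3 * j + 3)))"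
    "G_coeff a l (3 * j + 4) = of_int (a (l (3 * j + 4))) / 2"
    unfolding G_coeff_def two_powr_sin_half_pi by simp_all
qed

lemma v_coeff_simps:
  "v_coeff (3 * j + 2) = 1" "v_coeff (3 * j + 3) = 2" "v_coeff (3 * j + 4) = 1 / 2"
proof -
  have "(3 * j + 2 + 1 + (3 * j + 2 + 2) div 3) mod 4 = 0"
    "(3 * j + 3 + 1 + (3 * j + 3 + 2) div 3) mod 4 = 1"
    "(3 * j + 4 + 1 + (3 * j + 4 + 2) div 3) mod 4 = 3" by presburger+
  then show "v_coeff (3 * j + 2) = 1" "v_coeff (3 * j + 3) = 2" "v_coeff (3 * j + 4) = 1 / 2"
    unfolding v_coeff_def two_powr_sin_half_pi by simp_all
qed

lemma H_coeff_simps: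
  "H_coeff a l (4 * j + 2) = 2 * of_int (a (l (4 * j + 2)))"
  "H_coeff a l (4 * j + 3) = of_int (a (l (4 * j + 3)))"
  "H_coeff a l (4 * j + 4) = of_int (a (l (4 * j + 4)))"
  "H_coeff a l (4 * j + 5) = of_int (a (l (4 * j + 5))) / 2"
proof -
  have of_nat: "real (p + 2) + real ((p + 2) div 4) - real (p div 4) =
      real (p + 2 + ((p + 2) div 4 - p div 4))" for p
    by (simp add: of_nat_diff div_le_mono)
  have quot: "(4 * j + 2) div 4 = j" "(4 * j + 2 + 2) div 4 = j + 1"
    "(4 * j + 3) div 4 = j" "(4 * j + 3 + 2) div 4 = j + 1"
    "(4 * j + 4) div 4 = j + 1" "(4 * j + 4 + 2) div 4 = j + 1"
    "(4 * j + 5) div 4 = j + 1" "(4 * j + 5 + 2) div 4 = j + 1" by presburger+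
  have "(4 * j + 2 + 2 + ((4 * j + 2 + 2) div 4 - (4 * j + 2) div 4)) mod 4 = 1"
    "(4 * j + 3 + 2 + ((4 * j + 3 + 2) div 4 - (4 * j + 3) div 4)) mod 4 = 2"
    "(4 * j + 4 + 2 + ((4 * j + 4 + 2) div 4 - (4 * j + 4) div 4)) mod 4 = 2"
    "(4 * j + 5 + 2 + ((4 * j + 5 + 2) div 4 - (4 * j + 5) div 4)) mod 4 = 3"
    unfolding quot add_diff_cancel_left' diff_self_eq_0 by presburger+
  then show "H_coeff a l (4 * j + 2) = 2 * of_int (a (l (4 * j + 2)))"
    "H_coeff a l (4 * j + 3) = of_int (a (l (4 * j + 3)))"
    "H_coeff a l (4 * j + 4) = of_int (a (l (4 * j + 4)))"
    "H_coeff a l (4 * j + 5) = of_int (a (l (4 * j + 5))) / 2"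
    unfolding H_coeff_def of_nat two_powr_sin_half_pi by simp_all
qed

lemma z_coeff_simps:
  "z_coeff (4 * j + 2) = 1" "z_coeff (4 * j + 3) = 2"
  "z_coeff (4 * j + 4) = 1" "z_coeff (4 * j + 5) = 1 / 2"
proof -
  have "(4 * j + 2 + 2) mod 4 = 0" "(4 * j + 3 + 2) mod 4 = 1"
    "(4 * j + 4 + 2) mod 4 = 2" "(4 * j + 5 + 2) mod 4 = 3" by presburger+
  then show "z_coeff (4 * j + 2) = 1" "z_coeff (4 * j + 3) = 2"
    "z_coeff (4 * j + 4) = 1" "z_coeff (4 * j + 5) = 1 / 2"
    unfolding z_coeff_def two_powr_sin_half_pi by simp_all
qed

section \<open>The contracted recurrences\<close>

text \<open>From the second block of the tail on, every block \<open>c, 1, 1\<close> comes after a pair of ones, so a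
  single kind of step occurs; \<open>p \<ge> 2\<close> excludes the first block.\<close>

lemma contraction_CF1:
  assumes R: "cf_recurrence b R" and a: "CF1 a"
    and tail: "tail_1a a b (Suc p0)" and p: "p \<ge> 2"
  shows "R (s_idx p0 p) =
    a (Suc p0 + p - 2) * R (s_idx p0 (p - 1)) + R (s_idx p0 (p - 2))"
proof -
  obtain j where j: "p = j + 2" using p by (metis le_add_diff_inverse2)
  have blk: "b (p0 + 3 * i + 1) = (a (p0 + i) - 2) div 2"
      "b (p0 + 3 * i + 2) = 1" "b (p0 + 3 * i + 3) = 1" for i
    using cf_tail_block[of p0 b "[\<lambda>k. (a (k-1) - 2) div 2, \<lambda>k. 1, \<lambda>k. 1]" 3 0 i]
      cf_tail_block[of p0 b "[\<lambda>k. (a (k-1) - 2) div 2, \<lambda>k. 1, \<lambda>k. 1]" 3 1 i]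
      cf_tail_block[of p0 b "[\<lambda>k. (a (k-1) - 2) div 2, \<lambda>k. 1, \<lambda>k. 1]" 3 2 i] tail
    by (simp_all add: tail_1a_def eval_nat_numeral)
  have next_blk: "b (p0 + 3 * j + 4) = (a (p0 + j + 1) - 2) div 2"
      "b (p0 + 3 * j + 5) = 1" "b (p0 + 3 * j + 6) = 1"
    using blk[of "j + 1"] by (simp_all add: algebra_simps eval_nat_numeral)
  have "even (a (p0 + j + 1))" using a by (simp add: CF1_def)
  then have e: "2 * b (p0 + 3 * j + 4) + 2 = a (p0 + j + 1)"
    using next_blk(1) by auto
  have "R (p0 + 3 * j + 6) = a (p0 + j + 1) * R (p0 + 3 * j + 3) + R (p0 + 3 * j)"
    using step_between_ones[OF R blk(2)[of j] blk(3)[of j] next_blk(2,3)] e by simp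
  then show ?thesis
    unfolding s_idx_def j by (simp add: algebra_simps)
qed

text \<open>The three tails of type CF2 differ only by a shift of the indices of \<open>a\<close>, which is absorbed
  in \<open>l\<close>: the block number \<open>j\<close> of the tail contains the entries made of
  \<open>a (l p)\<close> for \<open>p = 3j + 1, 3j + 2, 3j + 3\<close>.\<close>

lemma contraction_odd_blocks:
  assumes R: "cf_recurrence b R" and odd: "\<And>i. odd (a i)"
    and blk: "\<And>j. b (p0 + 5 * j + 1) = (a (l (3 * j + 1)) - 1) div 2"
      "\<And>j. b (p0 + 5 * j + 2) = 2 * a (l (3 * j + 2))"
      "\<And>j. b (p0 + 5 * j + 3) = (a (l (3 * j + 3)) - 1) div 2"
      "\<And>j. b (p0 + 5 * j + 4) = 1" "\<And>j. b (p0 + 5 * j + 5) = 1"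
    and p: "p \<ge> 2"
  shows "real_of_int (R (g_idx p0 p)) =
    G_coeff a l p * R (g_idx p0 (p - 1)) + v_coeff p * R (g_idx p0 (p - 2))"
proof -
  have half: "2 * ((a i - 1) div 2) + 1 = a i" for i using odd[of i] by simp
  \<comment> \<open>Block \<open>j\<close> is paired with the first entry of block \<open>j + 1\<close>: the step at that entry
    eliminates the term skipped at the end of block \<open>j\<close>.\<close>
  define j where "j = (p - 2) div 3"
  define m where "m = p0 + 5 * j"
  have "p0 + 5 * (j + 1) + 1 = m + 6" "3 * (j + 1) + 1 = 3 * j + 4" unfolding m_def by simp_all
  note blk = blk(2-5)[of j, folded m_def] blk(1)[of "j + 1", unfolded this]
  consider "p = 3 * j + 2" | "p = 3 * j + 3" | "p = 3 * j + 4"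
    using p unfolding j_def by linarith
  then show ?thesis
  proof cases
    case 1
    have "R (m + 2) = 2 * a (l (3 * j + 2)) * R (m + 1) + R m"
      using R blk(1) by (simp add: cf_recurrence_def)
    moreover have idx: "p - 1 = 3 * j + 1" "p - 2 = 3 * j" using 1 by simp_all
    ultimately show ?thesis
      unfolding idx unfolding 1 g_idx_simps G_coeff_simps v_coeff_simps m_def[symmetric] by simp
  next
    case 2
    have "R (m + 5) = a (l (3 * j + 3)) * R (m + 2) + 2 * R (m + 1)"
      using step_into_ones[OF R, of "m + 1"] blk(2-4) half
      by (simp add: eval_nat_numeral)
    moreover have idx: "p - 1 = 3 * j + 2" "p - 2 = 3 * j + 1" using 2 by simp_all
    ultimately show ?thesis
      unfolding idx unfolding 2 g_idx_simps G_coeff_simps v_coeff_simps m_def[symmetric] by simp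
  next
    case 3
    have "2 * R (m + 6) = a (l (3 * j + 4)) * R (m + 5) + R (m + 2)"
      using step_out_of_ones[OF R, of "m + 2"] blk(3-5) half
      by (simp add: eval_nat_numeral)
    then have "2 * real_of_int (R (m + 6)) =
        of_int (a (l (3 * j + 4))) * of_int (R (m + 5)) + of_int (R (m + 2))"
      by (metis of_int_add of_int_mult of_int_numeral)
    moreover have idx: "p - 1 = 3 * j + 3" "p - 2 = 3 * j + 2" using 3 by simp_all
    ultimately show ?thesis
      unfolding idx unfolding 3 g_idx_simps G_coeff_simps v_coeff_simps m_def[symmetric] by simp
  qed
qed

text \<open>A block of types CF3 and CF4 is a block of type CF2 followed by one of type CF1, so that
  in addition to the three steps above there is one from a pair of ones to the next.\<close>

lemma contraction_mixed_blocks: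
  assumes R: "cf_recurrence b R"
    and odd: "\<And>j. odd (a (l (4 * j + 1)))" "\<And>j. odd (a (l (4 * j + 3)))"
    and even: "\<And>j. even (a (l (4 * j + 4)))"
    and blk: "\<And>j. b (p0 + 8 * j + 1) = (a (l (4 * j + 1)) - 1) div 2"
      "\<And>j. b (p0 + 8 * j + 2) = 2 * a (l (4 * j + 2))"
      "\<And>j. b (p0 + 8 * j + 3) = (a (l (4 * j + 3)) - 1) div 2"
      "\<And>j. b (p0 + 8 * j + 4) = 1" "\<And>j. b (p0 + 8 * j + 5) = 1"
      "\<And>j. b (p0 + 8 * j + 6) = (a (l (4 * j + 4)) - 2) div 2"
      "\<And>j. b (p0 + 8 * j + 7) = 1" "\<And>j. b (p0 + 8 * j + 8) = 1"
    and p: "p \<ge> 2"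
  shows "real_of_int (R (h_idx p0 p)) =
    H_coeff a l p * R (h_idx p0 (p - 1)) + z_coeff p * R (h_idx p0 (p - 2))"
proof -
  define j where "j = (p - 2) div 4"
  define m where "m = p0 + 8 * j"
  have "p0 + 8 * (j + 1) + 1 = m + 9" "4 * (j + 1) + 1 = 4 * j + 5" unfolding m_def by simp_all
  note next_idx = this
  note blk = blk(2-8)[of j, folded m_def] blk(1)[of "j + 1", unfolded next_idx]
  have d: "2 * b (m + 3) + 1 = a (l (4 * j + 3))" using blk(2) odd(2)[of j] by simp
  have e: "2 * b (m + 6) + 2 = a (l (4 * j + 4))" using blk(5) even[of j] by auto
  have d': "2 * b (m + 9) + 1 = a (l (4 * j + 5))"
    using blk(8) odd(1)[of "j + 1", unfolded next_idx] by simp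
  consider "p = 4 * j + 2" | "p = 4 * j + 3" | "p = 4 * j + 4" | "p = 4 * j + 5"
    using p unfolding j_def by linarith
  then show ?thesis
  proof cases
    case 1
    have "R (m + 2) = 2 * a (l (4 * j + 2)) * R (m + 1) + R m"
      using R blk(1) by (simp add: cf_recurrence_def)
    moreover have idx: "p - 1 = 4 * j + 1" "p - 2 = 4 * j" using 1 by simp_all
    ultimately show ?thesis
      unfolding idx unfolding 1 h_idx_simps H_coeff_simps z_coeff_simps m_def[symmetric] by simp
  next
    case 2
    have "R (m + 5) = a (l (4 * j + 3)) * R (m + 2) + 2 * R (m + 1)"
      using step_into_ones[OF R, of "m + 1"] blk(3,4) d
      by (simp add: eval_nat_numeral)
    moreover have idx: "p - 1 = 4 * j + 2" "p - 2 = 4 * j + 1" using 2 by simp_all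
    ultimately show ?thesis
      unfolding idx unfolding 2 h_idx_simps H_coeff_simps z_coeff_simps m_def[symmetric] by simp
  next
    case 3
    have "R (m + 8) = a (l (4 * j + 4)) * R (m + 5) + R (m + 2)"
      using step_between_ones[OF R, of "m + 2"] blk(3,4,6,7) e
      by (simp add: eval_nat_numeral)
    moreover have idx: "p - 1 = 4 * j + 3" "p - 2 = 4 * j + 2" using 3 by simp_all
    ultimately show ?thesis
      unfolding idx unfolding 3 h_idx_simps H_coeff_simps z_coeff_simps m_def[symmetric] by simp
  next
    case 4
    have "2 * R (m + 9) = a (l (4 * j + 5)) * R (m + 8) + R (m + 5)"
      using step_out_of_ones[OF R, of "m + 5"] blk(6,7) d'
      by (simp add: eval_nat_numeral)
    then have "2 * real_of_int (R (m + 9)) =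
        of_int (a (l (4 * j + 5))) * of_int (R (m + 8)) + of_int (R (m + 5))"
      by (metis of_int_add of_int_mult of_int_numeral)
    moreover have idx: "p - 1 = 4 * j + 4" "p - 2 = 4 * j + 3" using 4 by simp_all
    ultimately show ?thesis
      unfolding idx unfolding 4 h_idx_simps H_coeff_simps z_coeff_simps m_def[symmetric] by simp
  qed
qed

lemma CF3_parity: "CF3 a \<Longrightarrow> even (a i) \<longleftrightarrow> odd i"
  by (auto simp: CF3_def)

lemma CF4_parity: "CF4 a \<Longrightarrow> even (a i) \<longleftrightarrow> even i"
  by (auto simp: CF4_def)

text \<open>With the indices of the partial quotients of \<open>x\<close> in a block as parameters \<open>u\<close>, \<open>v\<close>,
  \<open>w\<close> (and \<open>y\<close> below), one statement serves all the tails of a given shape.\<close>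

lemma contraction_CF2:
  assumes R: "cf_recurrence b R" and a: "CF2 a"
    and tail: "cf_tail p0 b = cf_repeat
       [\<lambda>k. (a (u k) - 1) div 2, \<lambda>k. 2 * a (v k), \<lambda>k. (a (w k) - 1) div 2,
        \<lambda>k. 1, \<lambda>k. 1] (Suc p0)"
    and l: "\<And>j. l (3 * j + 1) = u (Suc p0 + j)" "\<And>j. l (3 * j + 2) = v (Suc p0 + j)"
      "\<And>j. l (3 * j + 3) = w (Suc p0 + j)"
    and p: "p \<ge> 2"
  shows "real_of_int (R (g_idx p0 p)) =
    G_coeff a l p * R (g_idx p0 (p - 1)) + v_coeff p * R (g_idx p0 (p - 2))"
proof (rule contraction_odd_blocks[OF R _ _ _ _ _ _ p])
  note blk = cf_tail_block[OF tail]
  fix j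
  show "odd (a j)" using a by (simp add: CF2_def)
  show "b (p0 + 5 * j + 1) = (a (l (3 * j + 1)) - 1) div 2"
    using blk[of 5 0 j] by (simp only: l) simp
  show "b (p0 + 5 * j + 2) = 2 * a (l (3 * j + 2))"
    using blk[of 5 1 j] by (simp only: l) simp
  show "b (p0 + 5 * j + 3) = (a (l (3 * j + 3)) - 1) div 2"
    using blk[of 5 2 j] by (simp only: l) simp
  show "b (p0 + 5 * j + 4) = 1" using blk[of 5 3 j] by simp
  show "b (p0 + 5 * j + 5) = 1" using blk[of 5 4 j] by simp
qed

lemma contraction_CF34:
  assumes R: "cf_recurrence b R"
    and odd: "\<And>j. odd (a (l (4 * j + 1)))" "\<And>j. odd (a (l (4 * j + 3)))"
    and even: "\<And>j. even (a (l (4 * j + 4)))"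
    and tail: "cf_tail p0 b = cf_repeat
       [\<lambda>k. (a (u k) - 1) div 2, \<lambda>k. 2 * a (v k), \<lambda>k. (a (w k) - 1) div 2,
        \<lambda>k. 1, \<lambda>k. 1, \<lambda>k. (a (y k) - 2) div 2, \<lambda>k. 1, \<lambda>k. 1] (Suc p0)"
    and l: "\<And>j. l (4 * j + 1) = u (Suc p0 + j)" "\<And>j. l (4 * j + 2) = v (Suc p0 + j)"
      "\<And>j. l (4 * j + 3) = w (Suc p0 + j)" "\<And>j. l (4 * j + 4) = y (Suc p0 + j)"
    and p: "p \<ge> 2"
  shows "real_of_int (R (h_idx p0 p)) =
    H_coeff a l p * R (h_idx p0 (p - 1)) + z_coeff p * R (h_idx p0 (p - 2))"
proof (rule contraction_mixed_blocks[where a = a and l = l, OF R odd even _ _ _ _ _ _ _ _ p])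
  note blk = cf_tail_block[OF tail]
  fix j
  show "b (p0 + 8 * j + 1) = (a (l (4 * j + 1)) - 1) div 2"
    using blk[of 8 0 j] by (simp only: l) simp
  show "b (p0 + 8 * j + 2) = 2 * a (l (4 * j + 2))"
    using blk[of 8 1 j] by (simp only: l) simp
  show "b (p0 + 8 * j + 3) = (a (l (4 * j + 3)) - 1) div 2"
    using blk[of 8 2 j] by (simp only: l) simp
  show "b (p0 + 8 * j + 4) = 1" using blk[of 8 3 j] by simp
  show "b (p0 + 8 * j + 5) = 1" using blk[of 8 4 j] by simp
  show "b (p0 + 8 * j + 6) = (a (l (4 * j + 4)) - 2) div 2"
    using blk[of 8 5 j] by (simp only: l) simp
  show "b (p0 + 8 * j + 7) = 1" using blk[of 8 6 j] by simp
  show "b (p0 + 8 * j + 8) = 1" using blk[of 8 7 j] by simp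
qed

theorem theorem3p1:
  fixes A B C D :: int and x :: real and a b U V :: "nat \<Rightarrow> int" and k0 p0 :: nat
  assumes det: "\<bar>A * D - B * C\<bar> = 2"
    and x_cf: "is_simple_cf a x"
    and sigma_cf: "is_simple_cf b ((of_int A * x + of_int B) / (of_int C * x + of_int D))"
    and U: "U = cf_num b"
    and V: "V = cf_den b"
    and k0: "k0 \<ge> 1"
    and p0: "p0 = k0 - 1"
  shows
    "(\<forall>l. CF1 a \<and> tail_1a a b k0 \<and> l = (\<lambda>p. k0 + p - 2) \<longrightarrow>
        (\<forall>p\<ge>2.
           U (s_idx p0 p) = a (l p) * U (s_idx p0 (p-1)) + U (s_idx p0 (p-2)) \<and>
           V (s_idx p0 p) = a (l p) * V (s_idx p0 (p-1)) + V (s_idx p0 (p-2))))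
     \<and>
     (\<forall>l. CF2 a \<and>
          (tail_2a a b k0 \<and> l = (\<lambda>p. 3 * k0 + p - 4) \<or>
           tail_2b a b k0 \<and> l = (\<lambda>p. 3 * k0 + p - 3) \<or>
           tail_2c a b k0 \<and> l = (\<lambda>p. 3 * k0 + p - 2)) \<longrightarrow>
        (\<forall>p\<ge>2.
           real_of_int (U (g_idx p0 p)) =
             G_coeff a l p * U (g_idx p0 (p-1)) + v_coeff p * U (g_idx p0 (p-2)) \<and>
           real_of_int (V (g_idx p0 p)) =
             G_coeff a l p * V (g_idx p0 (p-1)) + v_coeff p * V (g_idx p0 (p-2))))
     \<and>
     (\<forall>l. (CF3 a \<and> tail_3a a b k0 \<and> l = (\<lambda>p. 4 * k0 + p - 5) \<or>
           CF3 a \<and> tail_3b a b k0 \<and> l = (\<lambda>p. 4 * k0 + p - 3) \<or>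
           CF4 a \<and> tail_4a a b k0 \<and> l = (\<lambda>p. 4 * k0 + p - 4) \<or>
           CF4 a \<and> tail_4c a b k0 \<and> l = (\<lambda>p. 4 * k0 + p - 2)) \<longrightarrow>
        (\<forall>p\<ge>2.
           real_of_int (U (h_idx p0 p)) =
             H_coeff a l p * U (h_idx p0 (p-1)) + z_coeff p * U (h_idx p0 (p-2)) \<and>
           real_of_int (V (h_idx p0 p)) =
             H_coeff a l p * V (h_idx p0 (p-1)) + z_coeff p * V (h_idx p0 (p-2))))"
proof -
  have k0': "k0 = Suc p0" using k0 p0 by simp
  have UV: "cf_recurrence b U" "cf_recurrence b V"
    using cf_recurrence_cf_num[OF sigma_cf] cf_recurrence_cf_den[OF sigma_cf] U V by simp_all
  have type1: "R (s_idx p0 p) = a (l p) * R (s_idx p0 (p-1)) + R (s_idx p0 (p-2))"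
    if "cf_recurrence b R" "CF1 a \<and> tail_1a a b k0 \<and> l = (\<lambda>p. k0 + p - 2)" "p \<ge> 2" for R l p
    using contraction_CF1[of b R a p0 p] that by (simp add: k0')
  have type2: "real_of_int (R (g_idx p0 p)) =
      G_coeff a l p * R (g_idx p0 (p-1)) + v_coeff p * R (g_idx p0 (p-2))"
    if R: "cf_recurrence b R"
      and t: "CF2 a \<and> (tail_2a a b k0 \<and> l = (\<lambda>p. 3 * k0 + p - 4) \<or>
           tail_2b a b k0 \<and> l = (\<lambda>p. 3 * k0 + p - 3) \<or>
           tail_2c a b k0 \<and> l = (\<lambda>p. 3 * k0 + p - 2))" and p: "p \<ge> 2" for R l p
  proof -
    note c = contraction_CF2[OF R conjunct1[OF t] _ _ _ _ p, of p0]
    from conjunct2[OF t] show ?thesis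
    proof (elim disjE)
      assume t: "tail_2a a b k0 \<and> l = (\<lambda>p. 3 * k0 + p - 4)"
      show ?thesis
        by (rule c[of "\<lambda>k. 3*k-3" "\<lambda>k. 3*k-2" "\<lambda>k. 3*k-1"])
           (use t in \<open>simp_all add: tail_2a_def k0'\<close>)
    next
      assume t: "tail_2b a b k0 \<and> l = (\<lambda>p. 3 * k0 + p - 3)"
      show ?thesis
        by (rule c[of "\<lambda>k. 3*k-2" "\<lambda>k. 3*k-1" "\<lambda>k. 3*k"])
           (use t in \<open>simp_all add: tail_2b_def k0'\<close>)
    next
      assume t: "tail_2c a b k0 \<and> l = (\<lambda>p. 3 * k0 + p - 2)"
      show ?thesis
        by (rule c[of "\<lambda>k. 3*k-1" "\<lambda>k. 3*k" "\<lambda>k. 3*k+1"])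
           (use t in \<open>simp_all add: tail_2c_def k0'\<close>)
    qed
  qed
  have type34: "real_of_int (R (h_idx p0 p)) =
      H_coeff a l p * R (h_idx p0 (p-1)) + z_coeff p * R (h_idx p0 (p-2))"
    if R: "cf_recurrence b R"
      and t: "CF3 a \<and> tail_3a a b k0 \<and> l = (\<lambda>p. 4 * k0 + p - 5) \<or>
           CF3 a \<and> tail_3b a b k0 \<and> l = (\<lambda>p. 4 * k0 + p - 3) \<or>
           CF4 a \<and> tail_4a a b k0 \<and> l = (\<lambda>p. 4 * k0 + p - 4) \<or>
           CF4 a \<and> tail_4c a b k0 \<and> l = (\<lambda>p. 4 * k0 + p - 2)" and p: "p \<ge> 2" for R l p
  proof -
    note c = contraction_CF34[OF R _ _ _ _ _ _ _ _ p, of a l p0]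
    from t show ?thesis
    proof (elim disjE)
      assume t: "CF3 a \<and> tail_3a a b k0 \<and> l = (\<lambda>p. 4 * k0 + p - 5)"
      then have l: "l = (\<lambda>p. 4 * k0 + p - 5)" and cf: "CF3 a" and tail: "tail_3a a b k0"
        by blast+
      show ?thesis
        by (rule c[of "\<lambda>k. 4*k-4" "\<lambda>k. 4*k-3" "\<lambda>k. 4*k-2" "\<lambda>k. 4*k-1"])
           (use tail in \<open>simp_all add: l k0' CF3_parity[OF cf] tail_3a_def\<close>)
    next
      assume t: "CF3 a \<and> tail_3b a b k0 \<and> l = (\<lambda>p. 4 * k0 + p - 3)"
      then have l: "l = (\<lambda>p. 4 * k0 + p - 3)" and cf: "CF3 a" and tail: "tail_3b a b k0"
        by blast+
      show ?thesis
        by (rule c[of "\<lambda>k. 4*k-2" "\<lambda>k. 4*k-1" "\<lambda>k. 4*k" "\<lambda>k. 4*k+1"])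
           (use tail in \<open>simp_all add: l k0' CF3_parity[OF cf] tail_3b_def\<close>)
    next
      assume t: "CF4 a \<and> tail_4a a b k0 \<and> l = (\<lambda>p. 4 * k0 + p - 4)"
      then have l: "l = (\<lambda>p. 4 * k0 + p - 4)" and cf: "CF4 a" and tail: "tail_4a a b k0"
        by blast+
      show ?thesis
        by (rule c[of "\<lambda>k. 4*k-3" "\<lambda>k. 4*k-2" "\<lambda>k. 4*k-1" "\<lambda>k. 4*k"])
           (use tail in \<open>simp_all add: l k0' CF4_parity[OF cf] tail_4a_def\<close>)
    next
      assume t: "CF4 a \<and> tail_4c a b k0 \<and> l = (\<lambda>p. 4 * k0 + p - 2)"
      then have l: "l = (\<lambda>p. 4 * k0 + p - 2)" and cf: "CF4 a" and tail: "tail_4c a b k0"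
        by blast+
      show ?thesis
        by (rule c[of "\<lambda>k. 4*k-1" "\<lambda>k. 4*k" "\<lambda>k. 4*k+1" "\<lambda>k. 4*k+2"])
           (use tail in \<open>simp_all add: l k0' CF4_parity[OF cf] tail_4c_def\<close>)
    qed
  qed
  show ?thesis
  proof (intro conjI allI impI, goal_cases)
    case (1 l p)
    then show ?case by (rule type1[OF UV(1)])
  next
    case (2 l p)
    then show ?case by (rule type1[OF UV(2)])
  next
    case (3 l p)
    then show ?case by (rule type2[OF UV(1)])
  next
    case (4 l p)
    then show ?case by (rule type2[OF UV(2)])
  next
    case (5 l p)
    then show ?case by (rule type34[OF UV(1)])
  next
    case (6 l p)
    then show ?case by (rule type34[OF UV(2)])
  qed
qed

end
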